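(* Let $S$ be a set of $n$ sites with weights $w_1,\dots,w_n$ of minimum $1$ and total weight $W=\sum_i w_i$, placed at independent uniformly random positions on the $d$-dimensional torus $\mathbb T^d$ equipped with a $\mathfrak p$-norm. For every fixed $k$, the expected number of non-empty regions of the weighted order-$k$ Voronoi diagram of $S$ is $O(W)$ (with the constant depending only on $k,d,\mathfrak p$). The same holds for sites placed uniformly at random in the hypercube $[0,1]^d$ with the $\mathfrak p$-norm distance.
   Context: $\mathbb T^d$ is $[0,1]^d$ with opposite faces identified ($d$ a fixed constant), with distance $\mathrm{dist}(p,q)=\left(\sum_{i=1}^d|p_i-q_i|_\circ^{\mathfrak p}\right)^{1/\mathfrak p}$ (and $\max_i|p_i-q_i|_\circ$ for $\mathfrak p=\infty$), where $|a-b|_\circ=\min\{|a-b|,1-|a-b|\}$ and $\mathfrak p\in\mathbb N^+\cup\{\infty\}$ is fixed. For sites $s_1,\dots,s_n$ with weights $w_i$, let $\omega_i=w_i^{1/d}$; the weighted distance from a point $p$ to $s_i$ is $\mathrm{dist}(s_i,p)/\omega_i$. For $A\subseteq S$ with $|A|=k$, the order-$k$ Voronoi region of $A$ is the set of points $p$ for which there exists $r$ with $\mathrm{dist}(s_i,p)\le\omega_i r$ for all $s_i\in A$ and $\mathrm{dist}(s_i,p)>\omega_i r$ for all $s_i\notin A$. The weighted order-$k$ Voronoi diagram is the collection of non-empty order-$k$ regions. *)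

theory Defs
  imports "HOL-Analysis.Analysis" "HOL-Probability.Probability"
begin

text \<open>Circular coordinate distance on the unit circle [0,1) with 0 and 1 identified.\<close>
definition circ_dist :: "real \<Rightarrow> real \<Rightarrow> real" where
  "circ_dist a b = min \<bar>a - b\<bar> (1 - \<bar>a - b\<bar>)"

text \<open>Generic p-norm style distance built from a coordinate distance cd.
  The exponent p ranges over the positive naturals together with infinity (enat).\<close>
definition pdist :: "enat \<Rightarrow> (real \<Rightarrow> real \<Rightarrow> real) \<Rightarrow> real^'d \<Rightarrow> real^'d \<Rightarrow> real" where
  "pdist p cd x y =
     (if p = \<infinity> then Max (range (\<lambda>i. cd (x$i) (y$i)))
      else (\<Sum>i\<in>UNIV. (cd (x$i) (y$i)) ^ (the_enat p)) powr (1 / real (the_enat p)))"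

text \<open>Torus distance on T^d (points represented in [0,1]^d) and cube distance.\<close>
definition torus_dist :: "enat \<Rightarrow> real^'d \<Rightarrow> real^'d \<Rightarrow> real" where
  "torus_dist p x y = pdist p circ_dist x y"

definition cube_dist :: "enat \<Rightarrow> real^'d \<Rightarrow> real^'d \<Rightarrow> real" where
  "cube_dist p x y = pdist p (\<lambda>a b. \<bar>a - b\<bar>) x y"

definition unit_cube :: "(real^'d) set" where
  "unit_cube = {x. \<forall>j. 0 \<le> x$j \<and> x$j \<le> 1}"

definition omega :: "'d::finite itself \<Rightarrow> (nat \<Rightarrow> real) \<Rightarrow> nat \<Rightarrow> real" where
  "omega (_::'d itself) w i = w i powr (1 / real CARD('d))"

text \<open>The order-k Voronoi region of A (a subset of the site indices {..<n}), for sites s,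
  weights w and distance dst; points range over the unit cube
  (the representatives of the torus, resp. the hypercube itself).\<close>
definition voronoi_region ::
  "(real^'d \<Rightarrow> real^'d \<Rightarrow> real) \<Rightarrow> nat \<Rightarrow> (nat \<Rightarrow> real^'d) \<Rightarrow> (nat \<Rightarrow> real) \<Rightarrow> nat set \<Rightarrow> (real^'d) set"
where
  "voronoi_region dst n s w A =
     {q \<in> unit_cube. \<exists>r::real.
        (\<forall>i\<in>A. dst (s i) q \<le> omega TYPE('d) w i * r) \<and>
        (\<forall>i\<in>{..<n} - A. dst (s i) q > omega TYPE('d) w i * r)}"

definition num_regions ::
  "(real^'d \<Rightarrow> real^'d \<Rightarrow> real) \<Rightarrow> nat \<Rightarrow> nat \<Rightarrow> (nat \<Rightarrow> real^'d) \<Rightarrow> (nat \<Rightarrow> real) \<Rightarrow> nat"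
where
  "num_regions dst n k s w =
     card {A. A \<subseteq> {..<n} \<and> card A = k \<and> voronoi_region dst n s w A \<noteq> {}}"

definition random_sites :: "nat \<Rightarrow> (nat \<Rightarrow> real^'d) measure" where
  "random_sites n = PiM {..<n} (\<lambda>_. uniform_measure lborel (unit_cube :: (real^'d) set))"

end

theory Submission
  imports Defs
begin

text \<open>
  Let the region of \<open>A\<close> be non-empty, witnessed by a point \<open>q\<close> and a radius \<open>r\<close>. All distances are at
  most \<open>d\<close> and \<open>\<omega>\<^sub>j \<ge> 1\<close>, so \<open>r \<le> d\<close> without loss of generality. Choose a dyadic scale \<open>d / 2\<^sup>i\<close>
  comparable with \<open>r\<close> and round \<open>q\<close> to a point \<open>c\<close> of a grid of \<open>O(2\<^bsup>id\<^esup>)\<close> points. Then every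
  site \<open>s\<^sub>j\<close> with \<open>j \<in> A\<close> lies in a box around \<open>c\<close> whose side is proportional to \<open>\<omega>\<^sub>j / 2\<^sup>i\<close>, and every
  other site avoids a concentric box that is smaller by a constant factor. The probabilities of the
  two boxes differ by at most a constant factor \<open>K\<close>; if they were equal, the events for different \<open>A\<close>
  would be disjoint, so in general their probabilities add up to at most \<open>K\<^sup>k\<close> for each \<open>c\<close>.
  Scales are used up to the first with \<open>2\<^bsup>id\<^esup> \<ge> W\<close>. There \<open>r\<close> has no lower bound and the sites
  outside \<open>A\<close> are ignored, but the expected number of sites in the large boxes around \<open>c\<close> is \<open>O(1)\<close>,
  which is enough. All grids together have \<open>O(W)\<close> points.
\<close>

section \<open>Separation by product events\<close>

definition separation_event ::
  "'i set \<Rightarrow> ('i \<Rightarrow> 'a measure) \<Rightarrow> ('i \<Rightarrow> 'a set) \<Rightarrow> ('i \<Rightarrow> 'a set) \<Rightarrow> 'i set \<Rightarrow> ('i \<Rightarrow> 'a) set" where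
  "separation_event I M X Y A = (\<Pi>\<^sub>E i\<in>I. if i \<in> A then X i else space (M i) - Y i)"

lemma sets_separation_event:
  assumes "finite I" "\<And>i. i \<in> I \<Longrightarrow> X i \<in> sets (M i)" "\<And>i. i \<in> I \<Longrightarrow> Y i \<in> sets (M i)"
  shows "separation_event I M X Y A \<in> sets (PiM I M)"
  unfolding separation_event_def using assms by (intro sets_PiM_I_finite) auto

context finite_product_prob_space
begin

lemma prob_separation_event:
  assumes "A \<subseteq> I" and X: "\<And>i. i \<in> I \<Longrightarrow> X i \<in> sets (M i)" and Y: "\<And>i. i \<in> I \<Longrightarrow> Y i \<in> sets (M i)"
  shows "prob (separation_event I M X Y A) =
    (\<Prod>i\<in>A. M.prob i (X i)) * (\<Prod>i\<in>I - A. 1 - M.prob i (Y i))"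
proof -
  let ?Z = "\<lambda>i. if i \<in> A then X i else space (M i) - Y i"
  have "prob (separation_event I M X Y A) = (\<Prod>i\<in>I. M.prob i (?Z i))"
    unfolding separation_event_def using X Y by (intro prob_times) auto
  also have "\<dots> = (\<Prod>i\<in>I - A. M.prob i (?Z i)) * (\<Prod>i\<in>A. M.prob i (?Z i))"
    using assms(1) finite_index by (rule prod.subset_diff)
  also have "(\<Prod>i\<in>I - A. M.prob i (?Z i)) = (\<Prod>i\<in>I - A. 1 - M.prob i (Y i))"
    using Y by (intro prod.cong) (auto simp: M.prob_compl)
  finally show ?thesis by simp
qed

lemma sum_prob_separation_event_le_power:
  assumes X: "\<And>i. i \<in> I \<Longrightarrow> X i \<in> sets (M i)" and Y: "\<And>i. i \<in> I \<Longrightarrow> Y i \<in> sets (M i)"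
    and ratio: "\<And>i. i \<in> I \<Longrightarrow> M.prob i (X i) \<le> K * M.prob i (Y i)" and "0 \<le> K"
  shows "(\<Sum>A | A \<subseteq> I \<and> card A = k. prob (separation_event I M X Y A)) \<le> K ^ k"
proof -
  let ?y = "\<lambda>i. M.prob i (Y i)"
  have "(\<Sum>A | A \<subseteq> I \<and> card A = k. prob (separation_event I M X Y A))
      \<le> (\<Sum>A | A \<subseteq> I \<and> card A = k. K ^ k * ((\<Prod>i\<in>A. ?y i) * (\<Prod>i\<in>I - A. 1 - ?y i)))"
  proof (rule sum_mono)
    fix A assume "A \<in> {A. A \<subseteq> I \<and> card A = k}"
    hence A: "A \<subseteq> I" "card A = k" by auto
    have "(\<Prod>i\<in>A. M.prob i (X i)) \<le> (\<Prod>i\<in>A. K * ?y i)"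
      using ratio A(1) by (intro prod_mono) auto
    also have "\<dots> = K ^ k * (\<Prod>i\<in>A. ?y i)"
      by (simp add: prod.distrib A(2))
    finally have "(\<Prod>i\<in>A. M.prob i (X i)) * (\<Prod>i\<in>I - A. 1 - ?y i)
        \<le> K ^ k * (\<Prod>i\<in>A. ?y i) * (\<Prod>i\<in>I - A. 1 - ?y i)"
      by (intro mult_right_mono prod_nonneg) simp_all
    thus "prob (separation_event I M X Y A) \<le> K ^ k * ((\<Prod>i\<in>A. ?y i) * (\<Prod>i\<in>I - A. 1 - ?y i))"
      using prob_separation_event[OF A(1) X Y] by (simp add: mult.assoc)
  qed
  also have "\<dots> \<le> K ^ k * (\<Sum>A\<in>Pow I. (\<Prod>i\<in>A. ?y i) * (\<Prod>i\<in>I - A. 1 - ?y i))"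
    unfolding sum_distrib_left[symmetric] using finite_index \<open>0 \<le> K\<close>
    by (intro mult_left_mono sum_mono2 mult_nonneg_nonneg prod_nonneg) auto
  also have "(\<Sum>A\<in>Pow I. (\<Prod>i\<in>A. ?y i) * (\<Prod>i\<in>I - A. 1 - ?y i)) = (\<Prod>i\<in>I. ?y i + (1 - ?y i))"
    using finite_index by (simp only: prod_add)
  finally show ?thesis by simp
qed

lemma sum_prob_separation_event_le_exp:
  assumes X: "\<And>i. i \<in> I \<Longrightarrow> X i \<in> sets (M i)"
  shows "(\<Sum>A | A \<subseteq> I \<and> card A = k. prob (separation_event I M X (\<lambda>_. {}) A))
    \<le> exp (\<Sum>i\<in>I. M.prob i (X i))"
proof -
  have "(\<Sum>A | A \<subseteq> I \<and> card A = k. prob (separation_event I M X (\<lambda>_. {}) A))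
      = (\<Sum>A | A \<subseteq> I \<and> card A = k. \<Prod>i\<in>A. M.prob i (X i))"
    using X by (intro sum.cong) (auto simp: prob_separation_event)
  also have "\<dots> \<le> (\<Sum>A\<in>Pow I. \<Prod>i\<in>A. M.prob i (X i))"
    using finite_index by (intro sum_mono2 prod_nonneg) auto
  also have "\<dots> = (\<Prod>i\<in>I. M.prob i (X i) + 1)"
    using finite_index by (simp add: prod_add)
  also have "\<dots> \<le> (\<Prod>i\<in>I. exp (M.prob i (X i)))"
    by (intro prod_mono) (auto simp: add.commute exp_ge_add_one_self)
  also have "\<dots> = exp (\<Sum>i\<in>I. M.prob i (X i))"
    using finite_index by (simp add: exp_sum)
  finally show ?thesis .
qed

end

text \<open>The counting function need not be measurable and the lower integral is not additive: the sets
  \<open>E x A\<close> provide a measurable majorant.\<close>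
lemma nn_integral_card_le_sum_emeasure:
  assumes "finite \<A>" "finite X" and E: "\<And>x A. x \<in> X \<Longrightarrow> A \<in> \<A> \<Longrightarrow> E x A \<in> sets M"
    and cover: "AE s in M. \<forall>A\<in>\<A>. P s A \<longrightarrow> (\<exists>x\<in>X. s \<in> E x A)"
  shows "(\<integral>\<^sup>+ s. ennreal (real (card {A \<in> \<A>. P s A})) \<partial>M) \<le> (\<Sum>x\<in>X. \<Sum>A\<in>\<A>. emeasure M (E x A))"
proof -
  have "AE s in M. ennreal (real (card {A \<in> \<A>. P s A})) \<le> (\<Sum>x\<in>X. \<Sum>A\<in>\<A>. indicator (E x A) s)"
    using cover
  proof eventually_elim
    case (elim s)
    have "ennreal (real (card {A \<in> \<A>. P s A})) = (\<Sum>A | A \<in> \<A> \<and> P s A. 1)"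
      by (simp add: ennreal_of_nat_eq_real_of_nat)
    also have "\<dots> \<le> (\<Sum>A | A \<in> \<A> \<and> P s A. \<Sum>x\<in>X. indicator (E x A) s)"
    proof (rule sum_mono)
      fix A assume "A \<in> {A \<in> \<A>. P s A}"
      then obtain x where x: "x \<in> X" "s \<in> E x A" using elim by blast
      have "(1 :: ennreal) = indicator (E x A) s" using x by simp
      also have "\<dots> \<le> (\<Sum>x\<in>X. indicator (E x A) s)"
        using x \<open>finite X\<close> by (intro member_le_sum) auto
      finally show "(1 :: ennreal) \<le> (\<Sum>x\<in>X. indicator (E x A) s)" .
    qed
    also have "\<dots> \<le> (\<Sum>A\<in>\<A>. \<Sum>x\<in>X. indicator (E x A) s)"
      using \<open>finite \<A>\<close> by (intro sum_mono2) auto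
    also have "\<dots> = (\<Sum>x\<in>X. \<Sum>A\<in>\<A>. indicator (E x A) s)"
      by (rule sum.swap)
    finally show ?case .
  qed
  hence "(\<integral>\<^sup>+ s. ennreal (real (card {A \<in> \<A>. P s A})) \<partial>M)
      \<le> (\<integral>\<^sup>+ s. (\<Sum>x\<in>X. \<Sum>A\<in>\<A>. indicator (E x A) s) \<partial>M)"
    by (rule nn_integral_mono_AE)
  also have "\<dots> = (\<Sum>x\<in>X. \<Sum>A\<in>\<A>. emeasure M (E x A))"
    using E by (simp add: nn_integral_sum)
  finally show ?thesis .
qed

section \<open>Boxes in the unit cube\<close>

lemma unit_cube_eq_cbox: "(unit_cube :: (real^'d) set) = cbox 0 1"
  by (auto simp: unit_cube_def mem_box_cart)

lemma measure_unit_cube: "measure lborel (unit_cube :: (real^'d) set) = 1"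
  unfolding unit_cube_eq_cbox by (subst content_cbox_cart) (auto simp: interval_ne_empty_cart)

lemma emeasure_unit_cube: "emeasure lborel (unit_cube :: (real^'d) set) = 1"
  using measure_unit_cube
  by (subst emeasure_eq_ennreal_measure) (auto simp: unit_cube_eq_cbox emeasure_lborel_cbox_eq)

definition uniform_cube :: "(real^'d) measure" where
  "uniform_cube = uniform_measure lborel unit_cube"

lemma sets_uniform_cube [measurable_cong, simp]: "sets uniform_cube = sets borel"
  by (simp add: uniform_cube_def)

lemma space_uniform_cube [simp]: "space uniform_cube = UNIV"
  by (simp add: uniform_cube_def)

lemma prob_space_uniform_cube: "prob_space (uniform_cube :: (real^'d) measure)"
  unfolding uniform_cube_def by (rule prob_space_uniform_measure) (simp_all add: emeasure_unit_cube)

lemma measure_uniform_cube: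
  "S \<in> sets borel \<Longrightarrow> measure uniform_cube S = measure lborel (unit_cube \<inter> S)"
  unfolding uniform_cube_def
  by (subst measure_uniform_measure) (simp_all add: emeasure_unit_cube measure_unit_cube)

lemma AE_uniform_cube_mem: "AE x in uniform_cube. x \<in> unit_cube"
  unfolding uniform_cube_def by (rule AE_uniform_measureI) (auto simp: unit_cube_eq_cbox)

definition sup_box :: "real^'d \<Rightarrow> real \<Rightarrow> (real^'d) set" where
  "sup_box c \<rho> = cbox (c - vec \<rho>) (c + vec \<rho>)"

lemma mem_sup_box: "x \<in> sup_box c \<rho> \<longleftrightarrow> (\<forall>j. \<bar>x $ j - c $ j\<bar> \<le> \<rho>)"
  by (auto simp: sup_box_def mem_box_cart abs_le_iff algebra_simps)

lemma sets_sup_box [measurable]: "sup_box c \<rho> \<in> sets borel"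
  by (simp add: sup_box_def)

lemma measure_sup_box:
  fixes c :: "real^'d"
  assumes "0 \<le> \<rho>"
  shows "measure lborel (sup_box c \<rho>) = (2 * \<rho>) ^ CARD('d)"
  unfolding sup_box_def using assms
  by (subst content_cbox_cart) (auto simp: interval_ne_empty_cart)

definition torus_box :: "real^'d \<Rightarrow> real \<Rightarrow> (real^'d) set" where
  "torus_box c \<rho> = {x. \<forall>j. circ_dist (x $ j) (c $ j) \<le> \<rho>}"

lemma sets_torus_box [measurable]: "torus_box c \<rho> \<in> sets borel"
proof -
  have "closed (torus_box c \<rho>)" unfolding torus_box_def circ_dist_def
    by (intro closed_Collect_all closed_Collect_le continuous_intros)
  thus ?thesis by simp
qed

lemma torus_box_subset_translates:
  assumes c: "c \<in> unit_cube"
  shows "unit_cube \<inter> torus_box c \<rho> \<subseteq> (\<Union>v\<in>UNIV \<rightarrow>\<^sub>E {-1, 0, 1}. sup_box (c + vec_lambda v) \<rho>)"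
proof
  fix x assume x: "x \<in> unit_cube \<inter> torus_box c \<rho>"
  have "\<exists>v\<in>{-1, 0, 1}. \<bar>x $ j - (c $ j + v)\<bar> \<le> \<rho>" for j
  proof -
    have "0 \<le> x $ j" "x $ j \<le> 1" "0 \<le> c $ j" "c $ j \<le> 1" "circ_dist (x $ j) (c $ j) \<le> \<rho>"
      using x c by (auto simp: unit_cube_def torus_box_def)
    thus ?thesis unfolding circ_dist_def by simp linarith
  qed
  then obtain v where v: "\<And>j. v j \<in> {-1, 0, 1}" "\<And>j. \<bar>x $ j - (c $ j + v j)\<bar> \<le> \<rho>" by metis
  hence "v \<in> UNIV \<rightarrow>\<^sub>E {-1, 0, 1}" "x \<in> sup_box (c + vec_lambda v) \<rho>"
    by (auto simp: mem_sup_box)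
  thus "x \<in> (\<Union>v\<in>UNIV \<rightarrow>\<^sub>E {-1, 0, 1}. sup_box (c + vec_lambda v) \<rho>)" by blast
qed

lemma measure_torus_box_le:
  fixes c :: "real^'d"
  assumes c: "c \<in> unit_cube" and \<rho>: "0 \<le> \<rho>"
  shows "measure uniform_cube (torus_box c \<rho>) \<le> (6 * \<rho>) ^ CARD('d)"
proof -
  define V where "V = (UNIV :: 'd set) \<rightarrow>\<^sub>E {-1, 0, 1 :: real}"
  have finite_V: "finite V" unfolding V_def by (intro finite_PiE) auto
  have "measure uniform_cube (torus_box c \<rho>) = measure lborel (unit_cube \<inter> torus_box c \<rho>)"
    by (simp add: measure_uniform_cube)
  also have "\<dots> \<le> measure lborel (\<Union>v\<in>V. sup_box (c + vec_lambda v) \<rho>)"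
  proof (rule measure_mono_fmeasurable)
    show "(\<Union>v\<in>V. sup_box (c + vec_lambda v) \<rho>) \<in> fmeasurable lborel"
      using finite_V by (intro fmeasurable.finite_UN) (simp_all add: sup_box_def)
    show "unit_cube \<inter> torus_box c \<rho> \<subseteq> (\<Union>v\<in>V. sup_box (c + vec_lambda v) \<rho>)"
      unfolding V_def by (rule torus_box_subset_translates[OF c])
  qed (simp add: unit_cube_eq_cbox)
  also have "\<dots> \<le> (\<Sum>v\<in>V. measure lborel (sup_box (c + vec_lambda v) \<rho>))"
    using finite_V by (intro measure_UNION_le) simp_all
  also have "\<dots> = (\<Sum>v\<in>V. (2 * \<rho>) ^ CARD('d))"
    using \<rho> by (simp add: measure_sup_box)
  also have "\<dots> = 3 ^ CARD('d) * (2 * \<rho>) ^ CARD('d)"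
    by (simp add: V_def card_PiE)
  also have "\<dots> = (6 * \<rho>) ^ CARD('d)"
    by (simp add: power_mult_distrib[symmetric, of 3])
  finally show ?thesis .
qed

lemma measure_sup_box_ge:
  fixes c :: "real^'d"
  assumes c: "c \<in> unit_cube" and \<rho>: "0 \<le> \<rho>" "\<rho> \<le> 1"
  shows "\<rho> ^ CARD('d) \<le> measure uniform_cube (sup_box c \<rho>)"
proof -
  \<comment> \<open>the image of the unit cube under the homothety with centre \<open>c\<close> and ratio \<open>\<rho>\<close>\<close>
  let ?B = "cbox ((1 - \<rho>) *\<^sub>R c) ((1 - \<rho>) *\<^sub>R c + vec \<rho>)"
  have "?B \<subseteq> unit_cube \<inter> sup_box c \<rho>"
  proof
    fix x assume "x \<in> ?B"
    hence x: "(1 - \<rho>) * c $ j \<le> x $ j" "x $ j \<le> (1 - \<rho>) * c $ j + \<rho>" for j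
      by (auto simp: mem_box_cart)
    have "0 \<le> x $ j \<and> x $ j \<le> 1 \<and> \<bar>x $ j - c $ j\<bar> \<le> \<rho>" for j
    proof -
      have cj: "0 \<le> c $ j" "c $ j \<le> 1" using c by (auto simp: unit_cube_def)
      have "0 \<le> (1 - \<rho>) * c $ j" "(1 - \<rho>) * c $ j \<le> 1 - \<rho>"
        using \<rho> cj by (auto simp: mult_left_le)
      moreover have "0 \<le> \<rho> * c $ j" "\<rho> * c $ j \<le> \<rho>"
        using \<rho> cj by (auto simp: mult_left_le)
      ultimately show ?thesis using x[of j] by (simp add: algebra_simps abs_le_iff)
    qed
    thus "x \<in> unit_cube \<inter> sup_box c \<rho>" by (auto simp: unit_cube_def mem_sup_box)
  qed
  hence "measure lborel ?B \<le> measure lborel (unit_cube \<inter> sup_box c \<rho>)"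
    by (intro measure_mono_fmeasurable)
      (auto simp: unit_cube_eq_cbox sup_box_def intro: fmeasurable.Int)
  moreover have "measure lborel ?B = \<rho> ^ CARD('d)"
    using \<rho> by (subst content_cbox_cart) (auto simp: interval_ne_empty_cart)
  ultimately show ?thesis by (simp add: measure_uniform_cube)
qed

lemma measure_torus_box_doubling:
  fixes c :: "real^'d"
  assumes c: "c \<in> unit_cube" and \<rho>: "0 \<le> \<rho>" and \<kappa>: "1 \<le> \<kappa>"
  shows "measure uniform_cube (torus_box c (\<kappa> * \<rho>))
    \<le> (6 * \<kappa>) ^ CARD('d) * measure uniform_cube (sup_box c \<rho>)"
proof (cases "\<rho> \<le> 1")
  case True
  have "measure uniform_cube (torus_box c (\<kappa> * \<rho>)) \<le> (6 * (\<kappa> * \<rho>)) ^ CARD('d)"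
    using \<rho> \<kappa> by (intro measure_torus_box_le c) simp
  also have "\<dots> = (6 * \<kappa>) ^ CARD('d) * \<rho> ^ CARD('d)"
    by (simp add: power_mult_distrib)
  also have "\<dots> \<le> (6 * \<kappa>) ^ CARD('d) * measure uniform_cube (sup_box c \<rho>)"
    using \<kappa> \<rho> True by (intro mult_left_mono measure_sup_box_ge c) auto
  finally show ?thesis .
next
  case False
  interpret prob_space "uniform_cube :: (real^'d) measure" by (rule prob_space_uniform_cube)
  have "1 \<le> prob (sup_box c 1)"
    using measure_sup_box_ge[OF c, of 1] by simp
  also have "\<dots> \<le> prob (sup_box c \<rho>)"
  proof (rule finite_measure_mono)
    show "sup_box c 1 \<subseteq> sup_box c \<rho>"
      using False by (simp add: subset_iff mem_sup_box) (meson less_imp_le not_le order_trans)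
  qed simp
  finally have "prob (torus_box c (\<kappa> * \<rho>)) \<le> 1 * prob (sup_box c \<rho>)"
    using prob_le_1[of "torus_box c (\<kappa> * \<rho>)"] by linarith
  also have "\<dots> \<le> (6 * \<kappa>) ^ CARD('d) * prob (sup_box c \<rho>)"
    using \<kappa> by (intro mult_right_mono one_le_power) auto
  finally show ?thesis .
qed

section \<open>Comparison of the distances with the maximum distance\<close>

lemma circ_dist_triangle: "circ_dist a c \<le> circ_dist a b + \<bar>b - c\<bar>"
  unfolding circ_dist_def by linarith

lemma circ_dist_le_abs: "circ_dist a b \<le> \<bar>a - b\<bar>"
  unfolding circ_dist_def by simp

lemma circ_dist_nonneg: "0 \<le> a \<Longrightarrow> a \<le> 1 \<Longrightarrow> 0 \<le> b \<Longrightarrow> b \<le> 1 \<Longrightarrow> 0 \<le> circ_dist a b"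
  unfolding circ_dist_def by auto

lemma power_powr_inverse: "0 \<le> a \<Longrightarrow> 0 < m \<Longrightarrow> (a ^ m) powr (1 / real m) = a"
  by (simp add: real_root_power_cancel flip: root_powr_inverse)

lemma coord_le_pdist:
  fixes x y :: "real^'d"
  assumes p: "p \<ge> 1" and nonneg: "\<And>j. 0 \<le> cd (x $ j) (y $ j)"
  shows "cd (x $ j) (y $ j) \<le> pdist p cd x y"
proof (cases p)
  case infinity
  thus ?thesis by (auto simp: pdist_def)
next
  case (enat m)
  hence "0 < m" using p by (simp add: one_enat_def)
  hence "cd (x $ j) (y $ j) = (cd (x $ j) (y $ j) ^ m) powr (1 / real m)"
    by (simp add: power_powr_inverse nonneg)
  also have "\<dots> \<le> (\<Sum>i\<in>UNIV. cd (x $ i) (y $ i) ^ m) powr (1 / real m)"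
    by (intro powr_mono2 member_le_sum) (auto simp: nonneg)
  finally show ?thesis using enat by (simp add: pdist_def)
qed

lemma pdist_le_card_mult:
  fixes x y :: "real^'d"
  assumes p: "p \<ge> 1" and nonneg: "\<And>j. 0 \<le> cd (x $ j) (y $ j)" and le: "\<And>j. cd (x $ j) (y $ j) \<le> t"
  shows "pdist p cd x y \<le> real CARD('d) * t"
proof -
  have t: "0 \<le> t" using nonneg le order_trans by blast
  have d: "1 \<le> real CARD('d)" by (simp add: Suc_leI)
  show ?thesis
  proof (cases p)
    case infinity
    hence "pdist p cd x y \<le> t" using le by (auto simp: pdist_def)
    also have "t \<le> real CARD('d) * t" using mult_right_mono[OF d t] by simp
    finally show ?thesis .
  next
    case (enat m)
    hence m: "0 < m" using p by (simp add: one_enat_def)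
    have "(\<Sum>i\<in>(UNIV::'d set). cd (x $ i) (y $ i) ^ m) \<le> (\<Sum>i\<in>(UNIV::'d set). t ^ m)"
      by (intro sum_mono power_mono nonneg le)
    also have "\<dots> = real CARD('d) * t ^ m" by simp
    also have "\<dots> \<le> real CARD('d) ^ m * t ^ m"
      using m d t by (intro mult_right_mono self_le_power) auto
    also have "\<dots> = (real CARD('d) * t) ^ m" by (simp add: power_mult_distrib)
    finally have "(\<Sum>i\<in>(UNIV::'d set). cd (x $ i) (y $ i) ^ m) powr (1 / real m)
        \<le> ((real CARD('d) * t) ^ m) powr (1 / real m)"
      by (intro powr_mono2 sum_nonneg) (auto simp: nonneg)
    also have "\<dots> = real CARD('d) * t"
      using m t d by (intro power_powr_inverse) auto
    finally show ?thesis using enat by (simp add: pdist_def)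
  qed
qed

text \<open>All that is used about the \<open>p\<close>-norm. One notion covers both spaces because it bounds the distance
  below by the smaller, circular coordinate distance and above by the larger, linear one.\<close>
definition sup_comparable :: "(real^'d \<Rightarrow> real^'d \<Rightarrow> real) \<Rightarrow> bool" where
  "sup_comparable dst \<longleftrightarrow> (\<forall>x\<in>unit_cube. \<forall>y\<in>unit_cube.
     (\<forall>j. circ_dist (x $ j) (y $ j) \<le> dst x y) \<and>
     (\<forall>t. (\<forall>j. \<bar>x $ j - y $ j\<bar> \<le> t) \<longrightarrow> dst x y \<le> real CARD('d) * t))"

lemma sup_comparable_torus_dist:
  assumes "p \<ge> 1" shows "sup_comparable (torus_dist p :: real^'d \<Rightarrow> _)"
  unfolding sup_comparable_def torus_dist_def
  by (auto simp: unit_cube_def intro!: coord_le_pdist pdist_le_card_mult assms circ_dist_nonneg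
      intro: order_trans[OF circ_dist_le_abs])

lemma sup_comparable_cube_dist:
  assumes "p \<ge> 1" shows "sup_comparable (cube_dist p :: real^'d \<Rightarrow> _)"
  unfolding sup_comparable_def cube_dist_def
  by (auto simp: unit_cube_def intro!: pdist_le_card_mult assms
      intro: order_trans[OF circ_dist_le_abs coord_le_pdist[where cd = "\<lambda>a b. \<bar>a - b\<bar>"]])

lemma sup_comparable_le_card:
  fixes dst :: "real^'d \<Rightarrow> real^'d \<Rightarrow> real"
  assumes "sup_comparable dst" "x \<in> unit_cube" "y \<in> unit_cube"
  shows "dst x y \<le> real CARD('d)"
proof -
  have "\<bar>x $ j - y $ j\<bar> \<le> 1" for j
  proof -
    have "0 \<le> x $ j" "x $ j \<le> 1" "0 \<le> y $ j" "y $ j \<le> 1"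
      using assms(2,3) by (auto simp: unit_cube_def)
    thus ?thesis by linarith
  qed
  hence "dst x y \<le> real CARD('d) * 1"
    using assms unfolding sup_comparable_def by blast
  thus ?thesis by simp
qed

section \<open>Dyadic cells\<close>

definition grid :: "nat \<Rightarrow> (real^'d) set" where
  "grid m = (\<lambda>g. \<chi> j. real (g j) / real m) ` (UNIV \<rightarrow>\<^sub>E {..m})"

lemma finite_grid: "finite (grid m)"
  unfolding grid_def by (intro finite_imageI finite_PiE) auto

lemma grid_subset_unit_cube: "grid m \<subseteq> unit_cube"
  by (auto simp: grid_def unit_cube_def PiE_iff divide_le_eq_1)

lemma card_grid_le: "card (grid m :: (real^'d) set) \<le> (m + 1) ^ CARD('d)"
proof -
  have "card (grid m :: (real^'d) set) \<le> card ((UNIV :: 'd set) \<rightarrow>\<^sub>E {..m})"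
    unfolding grid_def by (intro card_image_le finite_PiE) auto
  thus ?thesis by (simp add: card_PiE)
qed

lemma grid_dense:
  fixes q :: "real^'d"
  assumes q: "q \<in> unit_cube" and m: "0 < m"
  obtains c where "c \<in> grid m" "q \<in> sup_box c (1 / real m)"
proof
  define g where "g j = nat \<lfloor>q $ j * real m\<rfloor>" for j
  have g: "g j \<le> m \<and> \<bar>q $ j - real (g j) / real m\<bar> \<le> 1 / real m" for j
  proof -
    have "0 \<le> q $ j" "q $ j \<le> 1" using q by (auto simp: unit_cube_def)
    hence "0 \<le> q $ j * real m" "q $ j * real m \<le> real m"
      using m by (auto simp: mult_left_le_one_le)
    hence "g j \<le> m" "\<bar>q $ j * real m - real (g j)\<bar> \<le> 1"
      unfolding g_def by linarith+
    moreover have "q $ j - real (g j) / real m = (q $ j * real m - real (g j)) / real m"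
      using m by (simp add: field_simps)
    ultimately show ?thesis by (simp add: abs_divide divide_right_mono)
  qed
  thus "(\<chi> j. real (g j) / real m) \<in> grid m"
    unfolding grid_def by (intro imageI) auto
  show "q \<in> sup_box (\<chi> j. real (g j) / real m) (1 / real m)"
    using g by (simp add: mem_sup_box)
qed

definition cells :: "nat \<Rightarrow> (nat \<times> (real^'d)) set" where
  "cells l = (SIGMA i:{..l}. grid (4 * 2 ^ i))"

lemma finite_cells: "finite (cells l)"
  unfolding cells_def by (intro finite_SigmaI finite_grid) simp

lemma sum_power_le_twice_last:
  fixes b :: "'a::linordered_semidom"
  assumes "2 \<le> b"
  shows "(\<Sum>i\<le>l. b ^ i) \<le> 2 * b ^ l"
proof (induction l)
  case (Suc l)
  have "2 * b ^ l \<le> b * b ^ l"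
    using assms order_trans[OF zero_le_numeral assms] by (intro mult_right_mono) auto
  thus ?case using Suc by (simp add: mult_2 add_mono)
qed (simp add: one_le_numeral)

lemma card_cells_le:
  "card (cells l :: (nat \<times> (real^'d)) set) \<le> 2 * 5 ^ CARD('d) * (2 ^ CARD('d)) ^ l"
proof -
  have "card (cells l :: (nat \<times> (real^'d)) set) = (\<Sum>i\<le>l. card (grid (4 * 2 ^ i) :: (real^'d) set))"
    unfolding cells_def by (intro card_SigmaI) (auto simp: finite_grid)
  also have "\<dots> \<le> (\<Sum>i\<le>l. 5 ^ CARD('d) * (2 ^ CARD('d)) ^ i)"
  proof (rule sum_mono)
    fix i
    have "card (grid (4 * 2 ^ i) :: (real^'d) set) \<le> (4 * 2 ^ i + 1) ^ CARD('d)"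
      by (rule card_grid_le)
    also have "\<dots> \<le> (5 * 2 ^ i) ^ CARD('d)"
      by (intro power_mono) auto
    also have "\<dots> = 5 ^ CARD('d) * (2 ^ CARD('d)) ^ i"
      by (simp add: power_mult_distrib mult.commute flip: power_mult)
    finally show "card (grid (4 * 2 ^ i) :: (real^'d) set) \<le> 5 ^ CARD('d) * (2 ^ CARD('d)) ^ i" .
  qed
  also have "\<dots> = 5 ^ CARD('d) * (\<Sum>i\<le>l. (2 ^ CARD('d)) ^ i)"
    by (simp add: sum_distrib_left)
  also have "\<dots> \<le> 5 ^ CARD('d) * (2 * (2 ^ CARD('d)) ^ l)"
    by (intro mult_left_mono sum_power_le_twice_last) (auto intro: self_le_power)
  finally show ?thesis by (simp add: mult_ac)
qed

lemma ex_dyadic_scale: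
  fixes r t :: real
  assumes "r \<le> t"
  shows "\<exists>i\<le>l. r \<le> t / 2 ^ i \<and> (i < l \<longrightarrow> t / (2 * 2 ^ i) < r)"
proof (induction l)
  case 0
  show ?case using assms by simp
next
  case (Suc l)
  then obtain i where i: "i \<le> l" "r \<le> t / 2 ^ i" "i < l \<longrightarrow> t / (2 * 2 ^ i) < r" by blast
  consider "i < l" | "i = l" "r \<le> t / 2 ^ Suc l" | "i = l" "t / 2 ^ Suc l < r"
    using i(1) by linarith
  thus ?case
  proof cases
    case 2
    thus ?thesis by blast
  qed (use i in \<open>auto intro!: exI[of _ i]\<close>)
qed

lemma ex_power_between:
  fixes x b :: real
  assumes "1 \<le> x" "1 < b"
  obtains l where "x \<le> b ^ l" "b ^ l \<le> b * x"
proof -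
  define l where "l = (LEAST l. x \<le> b ^ l)"
  have "\<exists>l. x \<le> b ^ l" using real_arch_pow[OF assms(2), of x] by (meson less_imp_le)
  hence ge: "x \<le> b ^ l" unfolding l_def by (rule LeastI_ex)
  have "b ^ l \<le> b * x"
  proof (cases l)
    case 0
    thus ?thesis using assms mult_mono[of 1 b 1 x] by simp
  next
    case (Suc l')
    hence "\<not> x \<le> b ^ l'" using not_less_Least[of l' "\<lambda>l. x \<le> b ^ l"] by (simp add: l_def)
    thus ?thesis using assms Suc by simp
  qed
  with ge show ?thesis by (rule that)
qed

section \<open>Regions and cells\<close>

lemma omega_ge_1: "1 \<le> w i \<Longrightarrow> 1 \<le> omega TYPE('d::finite) w i"
  unfolding omega_def by (rule ge_one_powr_ge_zero) auto

lemma omega_power: "1 \<le> w i \<Longrightarrow> omega TYPE('d::finite) w i ^ CARD('d) = w i"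
  unfolding omega_def by (simp add: powr_powr flip: powr_realpow)

definition outer_box :: "(nat \<Rightarrow> real) \<Rightarrow> nat \<Rightarrow> real^'d \<Rightarrow> nat \<Rightarrow> (real^'d) set" where
  "outer_box w m c i = torus_box c (8 * real CARD('d) * (omega TYPE('d) w i / (4 * real m)))"

definition inner_box :: "(nat \<Rightarrow> real) \<Rightarrow> nat \<Rightarrow> real^'d \<Rightarrow> nat \<Rightarrow> (real^'d) set" where
  "inner_box w m c i = sup_box c (omega TYPE('d) w i / (4 * real m))"

lemma sets_outer_box: "outer_box w m c i \<in> sets borel"
  by (simp add: outer_box_def sets_torus_box)

lemma sets_inner_box: "inner_box w m c i \<in> sets borel"
  by (simp add: inner_box_def sets_sup_box)

lemma mem_outer_box:
  fixes x :: "real^'d"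
  assumes dst: "sup_comparable dst" and x: "x \<in> unit_cube" and q: "q \<in> unit_cube"
    and w: "1 \<le> w i" and m: "0 < m" and c: "q \<in> sup_box c (1 / (4 * real m))"
    and r: "r \<le> real CARD('d) / real m" and near: "dst x q \<le> omega TYPE('d) w i * r"
  shows "x \<in> outer_box w m c i"
proof -
  let ?d = "real CARD('d)" and ?\<omega> = "omega TYPE('d) w i"
  have \<omega>: "1 \<le> ?\<omega>" using w by (simp add: omega_ge_1)
  have d: "1 \<le> ?d" by (simp add: Suc_leI)
  have "circ_dist (x $ j) (c $ j) \<le> 8 * ?d * (?\<omega> / (4 * real m))" for j
  proof -
    have "circ_dist (x $ j) (q $ j) \<le> dst x q"
      using dst x q by (auto simp: sup_comparable_def)
    also have "\<dots> \<le> ?\<omega> * (?d / real m)"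
      using near r \<omega> by (elim order_trans) (intro mult_left_mono, auto)
    finally have "circ_dist (x $ j) (q $ j) \<le> ?d * ?\<omega> / real m" by (simp add: mult.commute)
    moreover have "\<bar>q $ j - c $ j\<bar> \<le> ?d * ?\<omega> / real m"
    proof -
      have "\<bar>q $ j - c $ j\<bar> \<le> 1 / (4 * real m)" using c by (simp add: mem_sup_box)
      also have "\<dots> \<le> 1 / real m" using m by (intro divide_left_mono) auto
      also have "\<dots> \<le> ?d * ?\<omega> / real m"
        using d \<omega> mult_mono[of 1 ?d 1 ?\<omega>] by (intro divide_right_mono) auto
      finally show ?thesis .
    qed
    ultimately have "circ_dist (x $ j) (c $ j) \<le> ?d * ?\<omega> / real m + ?d * ?\<omega> / real m"
      by (rule order_trans[OF circ_dist_triangle add_mono])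
    thus ?thesis by simp
  qed
  thus ?thesis by (simp add: outer_box_def torus_box_def)
qed

lemma not_mem_inner_box:
  fixes x :: "real^'d"
  assumes dst: "sup_comparable dst" and x: "x \<in> unit_cube" and q: "q \<in> unit_cube"
    and w: "1 \<le> w i" and c: "q \<in> sup_box c (1 / (4 * real m))"
    and r: "real CARD('d) / (2 * real m) \<le> r" and far: "omega TYPE('d) w i * r < dst x q"
  shows "x \<notin> inner_box w m c i"
proof
  let ?d = "real CARD('d)" and ?\<omega> = "omega TYPE('d) w i"
  assume "x \<in> inner_box w m c i"
  hence inner: "\<bar>x $ j - c $ j\<bar> \<le> ?\<omega> / (4 * real m)" for j by (simp add: inner_box_def mem_sup_box)
  have \<omega>: "1 \<le> ?\<omega>" using w by (simp add: omega_ge_1)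
  have "\<bar>x $ j - q $ j\<bar> \<le> ?\<omega> / (2 * real m)" for j
  proof -
    have "\<bar>q $ j - c $ j\<bar> \<le> 1 / (4 * real m)" using c by (simp add: mem_sup_box)
    also have "\<dots> \<le> ?\<omega> / (4 * real m)" using \<omega> by (intro divide_right_mono) auto
    finally have "\<bar>x $ j - q $ j\<bar> \<le> 2 * (?\<omega> / (4 * real m))" using inner[of j] by linarith
    thus ?thesis by simp
  qed
  hence "dst x q \<le> ?d * (?\<omega> / (2 * real m))"
    using dst x q unfolding sup_comparable_def by blast
  also have "\<dots> = ?\<omega> * (?d / (2 * real m))" by simp
  also have "\<dots> \<le> ?\<omega> * r" using \<omega> r by (intro mult_left_mono) auto
  finally show False using far by simp
qed

definition cell_event ::
  "nat \<Rightarrow> (nat \<Rightarrow> real) \<Rightarrow> nat \<Rightarrow> nat \<times> (real^'d) \<Rightarrow> nat set \<Rightarrow> (nat \<Rightarrow> real^'d) set" where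
  "cell_event n w l = (\<lambda>(i, c). separation_event {..<n} (\<lambda>_. uniform_cube) (outer_box w (2 ^ i) c)
     (if i < l then inner_box w (2 ^ i) c else (\<lambda>_. {})))"

lemma voronoi_region_radius_le_card:
  fixes s :: "nat \<Rightarrow> real^'d"
  assumes dst: "sup_comparable dst" and w: "\<And>i. i < n \<Longrightarrow> 1 \<le> w i"
    and s: "\<And>i. i < n \<Longrightarrow> s i \<in> unit_cube" and A: "A \<subseteq> {..<n}"
    and q: "q \<in> voronoi_region dst n s w A"
  obtains r where "r \<le> real CARD('d)" "\<And>i. i \<in> A \<Longrightarrow> dst (s i) q \<le> omega TYPE('d) w i * r"
    "\<And>i. i \<in> {..<n} - A \<Longrightarrow> omega TYPE('d) w i * r < dst (s i) q"
proof -
  let ?\<omega> = "omega TYPE('d) w" and ?d = "real CARD('d)"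
  obtain r where q': "q \<in> unit_cube" and inside: "\<And>i. i \<in> A \<Longrightarrow> dst (s i) q \<le> ?\<omega> i * r"
    and outside: "\<And>i. i \<in> {..<n} - A \<Longrightarrow> ?\<omega> i * r < dst (s i) q"
    using q unfolding voronoi_region_def by blast
  have \<omega>: "1 \<le> ?\<omega> i" if "i < n" for i using omega_ge_1 w that by blast
  show ?thesis
  proof (rule that[of "min r ?d"])
    fix i assume "i \<in> A"
    hence i: "i < n" using A by auto
    have "dst (s i) q \<le> 1 * ?d" using sup_comparable_le_card[OF dst s[OF i] q'] by simp
    also have "\<dots> \<le> ?\<omega> i * ?d" using \<omega>[OF i] by (intro mult_right_mono) auto
    finally show "dst (s i) q \<le> ?\<omega> i * min r ?d" using inside[OF \<open>i \<in> A\<close>] by (simp add: min_def)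
  next
    fix i assume i: "i \<in> {..<n} - A"
    have "?\<omega> i * min r ?d \<le> ?\<omega> i * r" using \<omega>[of i] i by (intro mult_left_mono) auto
    thus "?\<omega> i * min r ?d < dst (s i) q" using outside[OF i] by linarith
  qed simp
qed

lemma voronoi_region_nonempty_cell_event:
  fixes s :: "nat \<Rightarrow> real^'d"
  assumes dst: "sup_comparable dst" and w: "\<And>i. i < n \<Longrightarrow> 1 \<le> w i"
    and s: "s \<in> {..<n} \<rightarrow>\<^sub>E unit_cube" and A: "A \<subseteq> {..<n}"
    and nonempty: "voronoi_region dst n s w A \<noteq> {}"
  shows "\<exists>x\<in>cells l. s \<in> cell_event n w l x A"
proof -
  let ?\<omega> = "omega TYPE('d) w" and ?d = "real CARD('d)"
  have s_cube: "s i \<in> unit_cube" if "i < n" for i using s that by auto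
  obtain q where q: "q \<in> voronoi_region dst n s w A" using nonempty by blast
  hence q_cube: "q \<in> unit_cube" by (simp add: voronoi_region_def)
  obtain r where r: "r \<le> ?d" and inside: "\<And>i. i \<in> A \<Longrightarrow> dst (s i) q \<le> ?\<omega> i * r"
    and outside: "\<And>i. i \<in> {..<n} - A \<Longrightarrow> ?\<omega> i * r < dst (s i) q"
    using voronoi_region_radius_le_card[OF dst w s_cube A q] by metis
  obtain a where a: "a \<le> l" "r \<le> ?d / 2 ^ a" "a < l \<Longrightarrow> ?d / (2 * 2 ^ a) < r"
    using ex_dyadic_scale[OF r, of l] by blast
  obtain c where c: "c \<in> grid (4 * 2 ^ a)" "q \<in> sup_box c (1 / real (4 * 2 ^ a))"
    using grid_dense[OF q_cube, of "4 * 2 ^ a"] by auto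
  have outer: "s i \<in> outer_box w (2 ^ a) c i" if "i \<in> A" for i
    using that A a c by (intro mem_outer_box[OF dst s_cube q_cube w _ _ _ inside]) auto
  have inner: "s i \<notin> inner_box w (2 ^ a) c i" if "i \<in> {..<n} - A" "a < l" for i
    using that a c by (intro not_mem_inner_box[OF dst s_cube q_cube w _ _ outside]) auto
  have "s \<in> cell_event n w l (a, c) A"
    using s outer inner by (auto simp: cell_event_def separation_event_def PiE_iff)
  moreover have "(a, c) \<in> cells l" using a c by (simp add: cells_def)
  ultimately show ?thesis by blast
qed

section \<open>The expected number of regions\<close>

lemma random_sites_eq_PiM: "random_sites n = PiM {..<n} (\<lambda>_. uniform_cube)"
  by (simp add: random_sites_def uniform_cube_def)

lemma finite_product_prob_space_uniform_cube:
  "finite_product_prob_space (\<lambda>_. uniform_cube :: (real^'d) measure) {..<n::nat}"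
proof -
  interpret prob_space "uniform_cube :: (real^'d) measure" by (rule prob_space_uniform_cube)
  show ?thesis by standard auto
qed

lemma AE_random_sites: "AE s in random_sites n. s \<in> {..<n} \<rightarrow>\<^sub>E unit_cube"
proof -
  have "AE s in random_sites n. \<forall>i\<in>{..<n}. s i \<in> unit_cube"
    unfolding random_sites_eq_PiM
    by (intro AE_finite_allI AE_PiM_component prob_space_uniform_cube AE_uniform_cube_mem) auto
  thus ?thesis using AE_space
    by eventually_elim (auto simp: random_sites_eq_PiM space_PiM PiE_iff)
qed

lemma sets_cell_event: "cell_event n w l x A \<in> sets (random_sites n)"
  unfolding cell_event_def random_sites_eq_PiM
  by (auto simp: sets_outer_box sets_inner_box split: prod.split intro!: sets_separation_event)

text \<open>The first summand is for the scales below the last, the second for the last scale.\<close>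
definition cell_bound :: "nat \<Rightarrow> nat \<Rightarrow> real" where
  "cell_bound d k = ((48 * real d) ^ d) ^ k + exp ((12 * real d) ^ d)"

lemma sum_measure_outer_box_le:
  fixes c :: "real^'d"
  assumes c: "c \<in> unit_cube" and w: "\<And>i. i < n \<Longrightarrow> 1 \<le> w i"
    and m: "(\<Sum>i<n. w i) \<le> real m ^ CARD('d)" "0 < m"
  shows "(\<Sum>i<n. measure uniform_cube (outer_box w m c i)) \<le> (12 * real CARD('d)) ^ CARD('d)"
proof -
  let ?d = "real CARD('d)"
  have "(\<Sum>i<n. measure uniform_cube (outer_box w m c i))
      \<le> (\<Sum>i<n. (12 * ?d / real m) ^ CARD('d) * w i)"
  proof (rule sum_mono)
    fix i assume "i \<in> {..<n}"
    hence i: "1 \<le> w i" using w by simp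
    have "measure uniform_cube (outer_box w m c i) \<le>
        (6 * (8 * ?d * (omega TYPE('d) w i / (4 * real m)))) ^ CARD('d)"
      unfolding outer_box_def using omega_ge_1[where 'd='d, of w i] i
      by (intro measure_torus_box_le c) auto
    also have "6 * (8 * ?d * (omega TYPE('d) w i / (4 * real m))) = 12 * ?d / real m * omega TYPE('d) w i"
      by simp
    also have "\<dots> ^ CARD('d) = (12 * ?d / real m) ^ CARD('d) * w i"
      using omega_power[where 'd='d, of w i] i by (simp only: power_mult_distrib)
    finally show "measure uniform_cube (outer_box w m c i) \<le> (12 * ?d / real m) ^ CARD('d) * w i" .
  qed
  also have "\<dots> = (12 * ?d) ^ CARD('d) * ((\<Sum>i<n. w i) / real m ^ CARD('d))"
    by (simp add: sum_distrib_left sum_divide_distrib power_divide)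
  also have "\<dots> \<le> (12 * ?d) ^ CARD('d) * 1"
    using m by (intro mult_left_mono) (simp_all add: divide_le_eq_1)
  finally show ?thesis by simp
qed

lemma sum_measure_cell_event_le:
  fixes x :: "nat \<times> (real^'d)"
  assumes x: "x \<in> cells l" and w: "\<And>i. i < n \<Longrightarrow> 1 \<le> w i"
    and l: "(\<Sum>i<n. w i) \<le> (2 ^ CARD('d)) ^ l"
  shows "(\<Sum>A | A \<subseteq> {..<n} \<and> card A = k. measure (random_sites n) (cell_event n w l x A))
    \<le> cell_bound CARD('d) k"
proof -
  let ?d = "real CARD('d)"
  interpret finite_product_prob_space "\<lambda>_. uniform_cube :: (real^'d) measure" "{..<n}"
    by (rule finite_product_prob_space_uniform_cube)
  obtain a c where ac: "x = (a, c)" "a \<le> l" "c \<in> unit_cube"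
    using x grid_subset_unit_cube by (auto simp: cells_def)
  have d: "1 \<le> ?d" by (simp add: Suc_leI)
  show ?thesis
  proof (cases "a < l")
    case True
    have "measure uniform_cube (outer_box w (2 ^ a) c i)
        \<le> (48 * ?d) ^ CARD('d) * measure uniform_cube (inner_box w (2 ^ a) c i)" if "i < n" for i
      using measure_torus_box_doubling[OF ac(3), of "omega TYPE('d) w i / (4 * 2 ^ a)" "8 * ?d"]
        omega_ge_1[where 'd='d, of w i] w[OF that] d
      by (simp add: outer_box_def inner_box_def)
    hence "(\<Sum>A | A \<subseteq> {..<n} \<and> card A = k. measure (random_sites n) (cell_event n w l x A))
        \<le> ((48 * ?d) ^ CARD('d)) ^ k"
      using True unfolding random_sites_eq_PiM cell_event_def ac
      by (auto simp: sets_outer_box sets_inner_box intro!: sum_prob_separation_event_le_power)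
    thus ?thesis unfolding cell_bound_def by (rule add_increasing2[rotated]) simp
  next
    case False
    hence "a = l" using ac by simp
    have "(\<Sum>A | A \<subseteq> {..<n} \<and> card A = k. measure (random_sites n) (cell_event n w l x A))
        \<le> exp (\<Sum>i<n. measure uniform_cube (outer_box w (2 ^ a) c i))"
      using False unfolding random_sites_eq_PiM cell_event_def ac
      by (auto simp: sets_outer_box intro!: sum_prob_separation_event_le_exp)
    also have "\<dots> \<le> exp ((12 * ?d) ^ CARD('d))"
      using l \<open>a = l\<close> w ac(3)
      by (intro exp_mono sum_measure_outer_box_le) (auto simp: mult.commute simp flip: power_mult)
    finally show ?thesis unfolding cell_bound_def by (rule add_increasing[rotated]) simp
  qed
qed

lemma expected_num_regions_le:
  fixes dst :: "real^'d \<Rightarrow> real^'d \<Rightarrow> real"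
  assumes dst: "sup_comparable dst" and n: "0 < n" and w: "\<And>i. i < n \<Longrightarrow> 1 \<le> w i"
  shows "(\<integral>\<^sup>+ s. ennreal (real (num_regions dst n k s w)) \<partial>random_sites n)
    \<le> ennreal (2 * 10 ^ CARD('d) * cell_bound CARD('d) k * (\<Sum>i<n. w i))"
proof -
  let ?W = "\<Sum>i<n. w i" and ?B = "cell_bound CARD('d) k" and ?\<A> = "{A. A \<subseteq> {..<n} \<and> card A = k}"
  let ?M = "random_sites n :: (nat \<Rightarrow> real^'d) measure"
  interpret finite_product_prob_space "\<lambda>_. uniform_cube :: (real^'d) measure" "{..<n}"
    by (rule finite_product_prob_space_uniform_cube)
  have B: "0 \<le> ?B" by (simp add: cell_bound_def)
  have "1 \<le> real n" using n by simp
  also have "\<dots> \<le> ?W" using sum_mono[of "{..<n}" "\<lambda>_. 1" w] w by simp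
  finally obtain l where l: "?W \<le> (2 ^ CARD('d)) ^ l" "(2 ^ CARD('d)) ^ l \<le> 2 ^ CARD('d) * ?W"
    using ex_power_between[of ?W "2 ^ CARD('d)"] by (auto simp: one_less_power)
  have "(\<integral>\<^sup>+ s. ennreal (real (num_regions dst n k s w)) \<partial>?M)
      = (\<integral>\<^sup>+ s. ennreal (real (card {A \<in> ?\<A>. voronoi_region dst n s w A \<noteq> {}})) \<partial>?M)"
    by (simp add: num_regions_def conj_assoc)
  also have "\<dots> \<le> (\<Sum>x\<in>cells l. \<Sum>A\<in>?\<A>. emeasure ?M (cell_event n w l x A))"
  proof (rule nn_integral_card_le_sum_emeasure)
    show "AE s in ?M. \<forall>A\<in>?\<A>. voronoi_region dst n s w A \<noteq> {} \<longrightarrow>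
        (\<exists>x\<in>cells l. s \<in> cell_event n w l x A)"
      using AE_random_sites by eventually_elim (auto intro: voronoi_region_nonempty_cell_event dst w)
  qed (simp_all add: finite_cells sets_cell_event)
  also have "\<dots> = ennreal (\<Sum>x\<in>cells l. \<Sum>A\<in>?\<A>. measure ?M (cell_event n w l x A))"
    unfolding random_sites_eq_PiM emeasure_eq_measure by (simp add: sum_nonneg)
  also have "\<dots> \<le> ennreal (\<Sum>x\<in>(cells l :: (nat \<times> (real^'d)) set). ?B)"
    using w l(1) by (intro ennreal_leI sum_mono sum_measure_cell_event_le) auto
  also have "(\<Sum>x\<in>(cells l :: (nat \<times> (real^'d)) set). ?B) \<le> 2 * 5 ^ CARD('d) * (2 ^ CARD('d)) ^ l * ?B"
    using card_cells_le[of l, where 'd='d, folded of_nat_le_iff[where 'a=real]] B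
    by (simp add: mult_right_mono)
  also have "\<dots> \<le> 2 * 5 ^ CARD('d) * (2 ^ CARD('d) * ?W) * ?B"
    using l(2) B by (intro mult_right_mono mult_left_mono) auto
  also have "\<dots> = 2 * 10 ^ CARD('d) * ?B * ?W"
    using power_mult_distrib[of "5 :: real" 2 "CARD('d)"] by simp
  finally show ?thesis by (simp add: ennreal_leI)
qed

theorem mainTheorem12:
  fixes p :: enat and k :: nat
  assumes "p \<ge> 1"
  shows "\<exists>C::real. \<forall>(n::nat) (w::nat \<Rightarrow> real).
           (\<forall>i<n. w i \<ge> 1) \<and> (\<exists>i<n. w i = 1) \<longrightarrow>
             (\<integral>\<^sup>+ s. ennreal (real (num_regions (torus_dist p :: real^'d \<Rightarrow> _) n k s w))
                 \<partial>(random_sites n :: (nat \<Rightarrow> real^'d) measure))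
               \<le> ennreal (C * (\<Sum>i<n. w i)) \<and>
             (\<integral>\<^sup>+ s. ennreal (real (num_regions (cube_dist p :: real^'d \<Rightarrow> _) n k s w))
                 \<partial>(random_sites n :: (nat \<Rightarrow> real^'d) measure))
               \<le> ennreal (C * (\<Sum>i<n. w i))"
  by (intro exI[of _ "2 * 10 ^ CARD('d) * cell_bound CARD('d) k"] allI impI conjI
      expected_num_regions_le sup_comparable_torus_dist sup_comparable_cube_dist assms) auto

end
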